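(* Let $X$ be a pervasive pre-Riesz space and let $B,D\subseteq X$ be two ideals such that $X=B\oplus D$ (algebraic direct sum). Then $B$ is a projection band, and $X=B\oplus B^{\mathrm{d}}$.
   Context: All vector spaces are real. An ordered vector space $X$ is a real vector space with a cone $X_+$ (closed under addition and multiplication by nonnegative scalars, $X_+\cap(-X_+)=\{0\}$), ordered by $x\le y$ iff $y-x\in X_+$. A linear subspace $D$ of an ordered vector space $Y$ is order dense in $Y$ if $y=\inf\{z\in D: y\le z\}$ for every $y\in Y$. An ordered vector space $X$ is a pre-Riesz space if there exist a vector lattice $Y$ and a bipositive linear map $i\colon X\to Y$ (i.e. $i(x)\ge 0$ iff $x\ge 0$) such that $i(X)$ is order dense in $Y$; then $(Y,i)$ is called a vector lattice cover of $X$. A pre-Riesz space $X$ is pervasive if for some (equivalently, every) vector lattice cover $(Y,i)$ of $X$, for every $y\in Y_+$ with $y\ne 0$ there is $x\in X$ with $0<i(x)\le y$. For $M\subseteq X$, $M^u$ is the set of upper bounds of $M$ in $X$. Elements $x,y\in X$ are disjoint, $x\perp y$, if $\{x+y,-x-y\}^u=\{x-y,-x+y\}^u$. The disjoint complement of $M\subseteq X$ is $M^{\mathrm{d}}=\{x\in X: x\perp y\text{ for all }y\in M\}$, and $M^{\mathrm{dd}}=(M^{\mathrm{d}})^{\mathrm{d}}$. A linear subspace $B$ is a band if $B^{\mathrm{dd}}=B$; a band $B$ is a projection band if $X=B\oplus B^{\mathrm{d}}$. A subset $M\subseteq X$ is solid if for all $x\in X$, $y\in M$ the inclusion $\{x,-x\}^u\supseteq\{y,-y\}^u$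 implies $x\in M$; an ideal is a solid linear subspace. *)

theory Defs
  imports Complex_Main "HOL-Library.Lub_Glb"
begin

text \<open>
  Ordered vector spaces are the types of class \<open>ordered_real_vector\<close>; the positive cone is
  \<open>{x. 0 \<le> x}\<close>. Vector lattices are the types of sort \<open>{ordered_real_vector, lattice}\<close>.
\<close>

definition order_dense :: "'b::ordered_real_vector set \<Rightarrow> bool"
  where "order_dense D \<longleftrightarrow> subspace D \<and> (\<forall>y. isGlb UNIV {z \<in> D. y \<le> z} y)"

definition bipositive :: "('a::ordered_real_vector \<Rightarrow> 'b::ordered_real_vector) \<Rightarrow> bool"
  where "bipositive i \<longleftrightarrow> (\<forall>x. 0 \<le> i x \<longleftrightarrow> 0 \<le> x)"

definition vector_lattice_cover ::
    "('a::ordered_real_vector \<Rightarrow> 'b::{ordered_real_vector, lattice}) \<Rightarrow> bool"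
  where "vector_lattice_cover i \<longleftrightarrow> linear i \<and> bipositive i \<and> order_dense (range i)"

text \<open>
  A pre-Riesz space is a type \<open>'a\<close> that has some vector lattice cover \<open>i :: 'a \<Rightarrow> 'b\<close>, and it is
  pervasive if some such \<open>i\<close> satisfies the predicate below. HOL cannot quantify over the type
  \<open>'b\<close> inside a formula, so the covering type and \<open>i\<close> are kept as parameters; a theorem that
  assumes \<open>pervasive_cover i\<close> for arbitrary \<open>'b\<close> and \<open>i\<close> is a theorem about all pervasive
  pre-Riesz spaces \<open>'a\<close>.
\<close>

definition pervasive_cover ::
    "('a::ordered_real_vector \<Rightarrow> 'b::{ordered_real_vector, lattice}) \<Rightarrow> bool"
  where "pervasive_cover i \<longleftrightarrow>
    vector_lattice_cover i \<and> (\<forall>y. 0 \<le> y \<and> y \<noteq> 0 \<longrightarrow> (\<exists>x. 0 < i x \<and> i x \<le> y))"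

definition upper_bounds :: "'a::ord set \<Rightarrow> 'a set"
  where "upper_bounds M = {z. \<forall>m\<in>M. m \<le> z}"

definition disj :: "'a::ordered_real_vector \<Rightarrow> 'a \<Rightarrow> bool"  (infix \<open>\<bottom>\<close> 50)
  where "x \<bottom> y \<longleftrightarrow> upper_bounds {x + y, - x - y} = upper_bounds {x - y, - x + y}"

definition disj_compl :: "'a::ordered_real_vector set \<Rightarrow> 'a set"
  where "disj_compl M = {x. \<forall>y\<in>M. x \<bottom> y}"

definition direct_sum_decomp :: "'a::real_vector set \<Rightarrow> 'a set \<Rightarrow> bool"
  where "direct_sum_decomp B D \<longleftrightarrow>
    subspace B \<and> subspace D \<and> B \<inter> D = {0} \<and> (\<forall>x. \<exists>b\<in>B. \<exists>d\<in>D. x = b + d)"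

definition band :: "'a::ordered_real_vector set \<Rightarrow> bool"
  where "band B \<longleftrightarrow> subspace B \<and> disj_compl (disj_compl B) = B"

definition projection_band :: "'a::ordered_real_vector set \<Rightarrow> bool"
  where "projection_band B \<longleftrightarrow> band B \<and> direct_sum_decomp B (disj_compl B)"

definition solid :: "'a::ordered_real_vector set \<Rightarrow> bool"
  where "solid M \<longleftrightarrow>
    (\<forall>x. \<forall>y\<in>M. upper_bounds {y, - y} \<subseteq> upper_bounds {x, - x} \<longrightarrow> x \<in> M)"

definition order_ideal :: "'a::ordered_real_vector set \<Rightarrow> bool"
  where "order_ideal M \<longleftrightarrow> subspace M \<and> solid M"

end

theory Submission
  imports Defs
begin

text \<open>
  Let \<open>b \<in> B\<close> and \<open>d \<in> D\<close>. If \<open>\<bar>i b\<bar> \<sqinter> \<bar>i d\<bar>\<close> were not \<open>0\<close> in the cover, pervasiveness would give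
  an \<open>x > 0\<close> with \<open>i x\<close> below it; by solidity \<open>x\<close> would lie in both \<open>B\<close> and \<open>D\<close>, contradicting
  \<open>B \<inter> D = {0}\<close>. So \<open>i b\<close> and \<open>i d\<close> have disjoint moduli, which gives \<open>b \<bottom> d\<close> already in \<open>'a\<close>
  (\<open>disj_of_inf_modulus_eq_0\<close>, \<open>ideals_disj\<close>). Hence \<open>D \<subseteq> B\<^sup>d\<close>.

  For the converse inclusion, let \<open>b + d \<in> B\<^sup>d\<close>. Disjointness of \<open>b + d\<close> from \<open>b\<close> says
  that \<open>{2 b + d, - 2 b - d}\<close> and \<open>{d, - d}\<close> have the same upper bounds. Solidity of
  \<open>D\<close> then puts \<open>2 b + d\<close>, hence \<open>b\<close>, into \<open>D\<close>, so \<open>b = 0\<close>. Thus \<open>B\<^sup>d = D\<close>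
  (\<open>disj_compl_ideal_summand\<close>), and by symmetry \<open>D\<^sup>d = B\<close>, which makes \<open>B\<close> a band.
\<close>

lemma upper_bounds_pair [simp]: "z \<in> upper_bounds {x, y} \<longleftrightarrow> x \<le> z \<and> y \<le> z"
  by (simp add: upper_bounds_def)

lemma disj_iff:
  "x \<bottom> y \<longleftrightarrow> (\<forall>z. x + y \<le> z \<and> - x - y \<le> z \<longleftrightarrow> x - y \<le> z \<and> - x + y \<le> z)"
  unfolding disj_def set_eq_iff by simp

lemma disj_commute: "x \<bottom> y \<longleftrightarrow> y \<bottom> x"
proof -
  have "y + x = x + y" "- y - x = - x - y" "y - x = - x + y" "- y + x = x - y"
    by simp_all
  then show ?thesis
    unfolding disj_iff by (simp only:) blast
qed

lemma double_nonneg_imp_nonneg: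
  fixes x :: "'a::ordered_real_vector"
  assumes "0 \<le> x + x"
  shows "0 \<le> x"
proof -
  have "0 \<le> (1/2) *\<^sub>R (x + x)"
    using assms by (intro scaleR_nonneg_nonneg) simp_all
  then show ?thesis
    by (simp add: scaleR_half_double)
qed

lemma nonneg_if_bounds_neg:
  fixes x z :: "'a::ordered_real_vector"
  assumes "x \<le> z" "- x \<le> z"
  shows "0 \<le> z"
proof (rule double_nonneg_imp_nonneg)
  show "0 \<le> z + z"
    using add_mono[OF assms] by simp
qed

lemma bipositive_le_iff:
  assumes "linear i" "bipositive i"
  shows "i x \<le> i y \<longleftrightarrow> x \<le> y"
proof -
  have "i x \<le> i y \<longleftrightarrow> 0 \<le> i (y - x)"
    by (simp add: linear_diff[OF assms(1)])
  then show ?thesis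
    using assms(2) by (simp add: bipositive_def)
qed

text \<open>
  In a vector lattice, an upper bound of \<open>\<plusminus>(u + v)\<close> is above \<open>u - v\<close> when \<open>u\<close> and \<open>v\<close> have
  disjoint moduli.
\<close>

lemma le_of_inf_modulus_eq_0:
  fixes u v z :: "'b::{ordered_real_vector, lattice}"
  assumes inf0: "inf (sup u (- u)) (sup v (- v)) = 0"
    and "u + v \<le> z" "- u - v \<le> z"
  shows "u - v \<le> z"
proof -
  define h where "h = (1/2) *\<^sub>R ((u - v) - z)"
  have hh: "h + h = (u - v) - z"
    unfolding h_def by (metis scaleR_half_double scaleR_right_distrib)
  \<comment> \<open>Half the defect \<open>u - v - z\<close> is below both \<open>u\<close> and \<open>- v\<close>, hence below both moduli.\<close>
  have "0 \<le> (u - h) + (u - h)"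
  proof -
    have "(u - h) + (u - h) = z - (- u - v)"
      using hh by (simp add: algebra_simps)
    then show ?thesis using assms(3) by (simp only: diff_ge_0_iff_ge)
  qed
  then have "h \<le> u"
    using double_nonneg_imp_nonneg[of "u - h"] by simp
  have "0 \<le> (- v - h) + (- v - h)"
  proof -
    have "(- v - h) + (- v - h) = z - (u + v)"
      using hh by (simp add: algebra_simps)
    then show ?thesis using assms(2) by (simp only: diff_ge_0_iff_ge)
  qed
  then have "h \<le> - v"
    using double_nonneg_imp_nonneg[of "- v - h"] by simp
  have "h \<le> inf (sup u (- u)) (sup v (- v))"
    using \<open>h \<le> u\<close> \<open>h \<le> - v\<close> by (simp add: le_supI1 le_supI2)
  then have "h \<le> 0"
    by (simp add: inf0)
  then have "h + h \<le> 0"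
    using add_mono[of h 0 h 0] by simp
  then show ?thesis
    by (simp add: hh)
qed

lemma bounds_of_inf_modulus_eq_0:
  fixes i :: "'a::ordered_real_vector \<Rightarrow> 'b::{ordered_real_vector, lattice}"
  assumes lin: "linear i" and bip: "bipositive i"
    and inf0: "inf (sup (i x) (- i x)) (sup (i y) (- i y)) = 0"
    and z: "x + y \<le> z" "- x - y \<le> z"
  shows "x - y \<le> z" "- x + y \<le> z"
proof -
  note le = bipositive_le_iff[OF lin bip]
  note hom = linear_add[OF lin] linear_diff[OF lin] linear_neg[OF lin]
  have iz: "i x + i y \<le> i z" "- i x - i y \<le> i z"
    using z by (simp_all add: le flip: hom)
  have "i (x - y) \<le> i z"
    using le_of_inf_modulus_eq_0[OF inf0 iz] by (simp add: hom)
  then show "x - y \<le> z" by (simp add: le)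
  have "i y - i x \<le> i z"
  proof (rule le_of_inf_modulus_eq_0)
    show "inf (sup (i y) (- i y)) (sup (i x) (- i x)) = 0"
      using inf0 by (simp add: inf_commute)
    show "i y + i x \<le> i z"
      using iz(1) by (simp only: add.commute)
    show "- i y - i x \<le> i z"
      using iz(2) by (metis add.commute diff_conv_add_uminus)
  qed
  then have "i (- x + y) \<le> i z" by (simp add: hom)
  then show "- x + y \<le> z" by (simp only: le)
qed

lemma disj_of_inf_modulus_eq_0:
  fixes i :: "'a::ordered_real_vector \<Rightarrow> 'b::{ordered_real_vector, lattice}"
  assumes lin: "linear i" and bip: "bipositive i"
    and inf0: "inf (sup (i x) (- i x)) (sup (i y) (- i y)) = 0"
  shows "x \<bottom> y"
proof -
  have "inf (sup (i x) (- i x)) (sup (i (- y)) (- i (- y))) = 0"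
    using inf0 by (simp add: linear_neg[OF lin] sup_commute)
  \<comment> \<open>Replacing \<open>y\<close> by \<open>- y\<close> turns one inclusion of upper bounds into the reverse one.\<close>
  from bounds_of_inf_modulus_eq_0[OF lin bip this]
    bounds_of_inf_modulus_eq_0[OF lin bip inf0]
  show ?thesis
    unfolding disj_iff by simp blast
qed

lemma ideal_contains_below_modulus:
  fixes i :: "'a::ordered_real_vector \<Rightarrow> 'b::{ordered_real_vector, lattice}"
  assumes lin: "linear i" and bip: "bipositive i"
    and M: "order_ideal M" "y \<in> M"
    and x: "0 \<le> x" "i x \<le> sup (i y) (- i y)"
  shows "x \<in> M"
proof -
  note le = bipositive_le_iff[OF lin bip]
  have "upper_bounds {y, - y} \<subseteq> upper_bounds {x, - x}"
  proof
    fix z assume z: "z \<in> upper_bounds {y, - y}"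
    then have "i y \<le> i z" "i (- y) \<le> i z"
      by (simp_all only: le upper_bounds_pair)
    then have "sup (i y) (- i y) \<le> i z"
      by (simp add: linear_neg[OF lin])
    with x have "x \<le> z"
      by (metis le order_trans)
    moreover have "- x \<le> z"
      using x \<open>x \<le> z\<close> by (meson neg_le_0_iff_le order_trans)
    ultimately show "z \<in> upper_bounds {x, - x}" by simp
  qed
  with M show ?thesis
    by (auto simp: order_ideal_def solid_def)
qed

lemma ideals_disj:
  fixes i :: "'a::ordered_real_vector \<Rightarrow> 'b::{ordered_real_vector, lattice}"
    and B D :: "'a set"
  assumes perv: "pervasive_cover i"
    and ideals: "order_ideal B" "order_ideal D" and "B \<inter> D = {0}"
    and mem: "b \<in> B" "d \<in> D"
  shows "b \<bottom> d"
proof -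
  have lin: "linear i" and bip: "bipositive i"
    using perv by (simp_all add: pervasive_cover_def vector_lattice_cover_def)
  let ?y = "inf (sup (i b) (- i b)) (sup (i d) (- i d))"
  have "0 \<le> ?y"
    by (intro le_infI nonneg_if_bounds_neg[OF sup_ge1 sup_ge2])
  have "?y = 0"
  proof (rule ccontr)
    assume "?y \<noteq> 0"
    with \<open>0 \<le> ?y\<close> obtain x where x: "0 < i x" "i x \<le> ?y"
      using perv unfolding pervasive_cover_def by blast
    have "0 \<le> x"
      using bip less_imp_le[OF x(1)] by (simp add: bipositive_def)
    moreover have "i x \<le> sup (i b) (- i b)" "i x \<le> sup (i d) (- i d)"
      using x(2) by simp_all
    ultimately have "x \<in> B \<inter> D"
      using ideal_contains_below_modulus[OF lin bip] ideals mem by blast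
    then have "x = 0"
      using \<open>B \<inter> D = {0}\<close> by blast
    then show False
      using x(1) by (simp add: linear_0[OF lin])
  qed
  then show ?thesis
    by (rule disj_of_inf_modulus_eq_0[OF lin bip])
qed

lemma disj_compl_ideal_summand:
  fixes B D :: "'a::ordered_real_vector set"
  assumes D: "order_ideal D" and dec: "direct_sum_decomp B D"
    and orth: "\<And>b d. b \<in> B \<Longrightarrow> d \<in> D \<Longrightarrow> b \<bottom> d"
  shows "disj_compl B = D"
proof
  show "D \<subseteq> disj_compl B"
    unfolding disj_compl_def using orth disj_commute by blast
  show "disj_compl B \<subseteq> D"
  proof
    fix x assume x: "x \<in> disj_compl B"
    have D_sub: "subspace D" and BD: "B \<inter> D = {0}"
      using dec by (simp_all add: direct_sum_decomp_def)
    obtain b d where bd: "b \<in> B" "d \<in> D" "x = b + d"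
      using dec unfolding direct_sum_decomp_def by blast
    have "x \<bottom> b"
      using x bd(1) by (simp add: disj_compl_def)
    moreover have "x - b = d" "- x + b = - d" "- x - b = - (x + b)"
      by (simp_all add: bd(3))
    ultimately have "upper_bounds {x + b, - (x + b)} = upper_bounds {d, - d}"
      by (simp only: disj_def)
    then have "x + b \<in> D"
      using D bd(2) unfolding order_ideal_def solid_def by (metis order_refl)
    then have "x + b - d \<in> D"
      using subspace_diff[OF D_sub] bd(2) by blast
    moreover have "x + b - d = 2 *\<^sub>R b"
      by (simp add: bd(3) scaleR_2)
    ultimately have "2 *\<^sub>R b \<in> D"
      by (simp only:)
    then have "(1/2) *\<^sub>R (2 *\<^sub>R b) \<in> D"
      by (rule subspace_scale[OF D_sub])
    then have "b = 0"
      using bd(1) BD by auto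
    with bd show "x \<in> D" by simp
  qed
qed

theorem theorem17:
  fixes i :: "'a::ordered_real_vector \<Rightarrow> 'b::{ordered_real_vector, lattice}"
    and B D :: "'a set"
  assumes "pervasive_cover i"
    and "order_ideal B" and "order_ideal D"
    and "direct_sum_decomp B D"
  shows "projection_band B \<and> direct_sum_decomp B (disj_compl B)"
proof -
  have BD: "B \<inter> D = {0}" and sub: "subspace B"
    using assms(4) by (simp_all add: direct_sum_decomp_def)
  have dec': "direct_sum_decomp D B"
    using assms(4) unfolding direct_sum_decomp_def
    by (metis Int_commute add.commute)
  have orth: "b \<bottom> d" if "b \<in> B" "d \<in> D" for b d
    using ideals_disj[OF assms(1-3) BD that] .
  have Bd: "disj_compl B = D"
    using disj_compl_ideal_summand[OF assms(3,4) orth] .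
  have Dd: "disj_compl D = B"
    using disj_compl_ideal_summand[OF assms(2) dec'] orth disj_commute by blast
  show ?thesis
    using assms(4) sub by (simp add: projection_band_def band_def Bd Dd)
qed

end
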